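(* Let $n$ be an even positive integer and let $P = \overline{\mathcal{P}_{n/2,n}}$. For any positive integer $k \le n/100$ and any set $\mathcal{D}$ of inequalities valid for $P$ with $|\mathcal{D}| \le \exp\left(\frac{n}{600^2}\right)$, we have $$d\left(P, P^{k,\mathcal{D}}\right) \ge \frac{1}{6}\sqrt{n}.$$
   Context: For a real $t$ and a positive integer $n$, $\mathcal{P}_{t,n} = \{x \in [0,1]^n : \sum_{i=1}^n x_i \le t\}$. For $x \in \mathbb{R}^n$ and $I \subseteq [n] = \{1,\dots,n\}$, $x^I \in \mathbb{R}^n$ is the vector with $x^I_i = x_i$ if $i \in I$ and $x^I_i = -x_i$ if $i \notin I$; for $P \subseteq \mathbb{R}^n$, $P^I = \{x^I : x \in P\}$. For a polytope $P \subseteq \mathbb{R}^n_+$ its symmetrized version is $\overline{P} = \mathrm{conv}\left(\bigcup_{I \subseteq [n]} P^I\right)$. An inequality $\alpha x \le \beta$ (with $\alpha\in\mathbb{R}^n$, $\beta\in\mathbb{R}$, and $\alpha x$ denoting the inner product) is called $k$-sparse if $\alpha$ has at most $k$ non-zero components. It is valid for $P\subseteq\mathbb{R}^n$ if it is satisfied by all points of $P$. For a polytope $P \subset \mathbb{R}^n$ and a positive integer $k$, $P^k$ (integer superscript) denotes the set of points of $\mathbb{R}^n$ satisfying all $k$-sparse inequalities valid for $P$. For a finite set $\mathcal{D} = \{\alpha_1 x \le \beta_1, \dots, \alpha_d x \le \beta_d\}$ of (possibly dense) valid inequalities for $P$, $P^{k,\mathcal{D}} = P^k \cap \bigcap_{i=1}^d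 \{x \in \mathbb{R}^n : \alpha_i x \le \beta_i\}$. For polytopes $P \subseteq Q$ in $\mathbb{R}^n$, $d(P,Q) = \max_{x\in Q}\min_{y \in P}\|x-y\|$, where $\|\cdot\|$ is the Euclidean norm. *)

theory Defs
  imports "HOL-Analysis.Analysis"
begin

definition budget_polytope :: "real \<Rightarrow> (real ^ 'n) set" where
  "budget_polytope t = {x. (\<forall>i. 0 \<le> x $ i \<and> x $ i \<le> 1) \<and> (\<Sum>i\<in>UNIV. x $ i) \<le> t}"

definition flip :: "'n set \<Rightarrow> real ^ 'n \<Rightarrow> real ^ 'n" where
  "flip I x = (\<chi> i. if i \<in> I then x $ i else - x $ i)"

definition symmetrized :: "(real ^ 'n) set \<Rightarrow> (real ^ 'n) set" where
  "symmetrized P = convex hull (\<Union>I. flip I ` P)"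

definition sparse :: "nat \<Rightarrow> real ^ 'n \<Rightarrow> bool" where
  "sparse k a \<longleftrightarrow> card {i. a $ i \<noteq> 0} \<le> k"

text \<open>An inequality \<open>a \<bullet> x \<le> b\<close> is represented by the pair \<open>(a, b)\<close>.\<close>

definition valid_ineq :: "(real ^ 'n) set \<Rightarrow> (real ^ 'n) \<times> real \<Rightarrow> bool" where
  "valid_ineq P c \<longleftrightarrow> (\<forall>x\<in>P. fst c \<bullet> x \<le> snd c)"

definition sparse_closure :: "nat \<Rightarrow> (real ^ 'n) set \<Rightarrow> (real ^ 'n) set" where
  "sparse_closure k P =
     {x. \<forall>a b. sparse k a \<longrightarrow> valid_ineq P (a, b) \<longrightarrow> a \<bullet> x \<le> b}"

definition sparse_closure_with ::
  "nat \<Rightarrow> ((real ^ 'n) \<times> real) set \<Rightarrow> (real ^ 'n) set \<Rightarrow> (real ^ 'n) set" where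
  "sparse_closure_with k D P = sparse_closure k P \<inter> (\<Inter>(a, b)\<in>D. {x. a \<bullet> x \<le> b})"

text \<open>Supremum and infimum are attained when both sets are compact and nonempty, see
  \<open>poly_dist_max_min\<close>. That the sets of interest are so follows from
  \<open>compact_symmetrized_budget_polytope\<close>, \<open>symmetrized_budget_polytope_nonempty\<close>,
  \<open>compact_sparse_closure_with\<close> and \<open>subset_sparse_closure_with\<close>.\<close>

definition poly_dist :: "(real ^ 'n) set \<Rightarrow> (real ^ 'n) set \<Rightarrow> real" where
  "poly_dist P Q = (SUP x\<in>Q. INF y\<in>P. norm (x - y))"

lemma poly_dist_max_min:
  fixes P Q :: "(real ^ 'n) set"
  assumes "compact P" "P \<noteq> {}" "compact Q" "Q \<noteq> {}"
  shows "\<exists>x\<in>Q. \<exists>y\<in>P. poly_dist P Q = norm (x - y) \<and> (\<forall>y'\<in>P. norm (x - y) \<le> norm (x - y'))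
           \<and> (\<forall>x'\<in>Q. \<exists>y'\<in>P. norm (x' - y') \<le> norm (x - y))"
proof -
  have inf: "(INF y\<in>P. norm (x - y)) = infdist x P" for x
    using assms(2) by (simp add: infdist_def dist_norm)
  have "continuous_on Q (\<lambda>x. infdist x P)"
    by (intro continuous_intros)
  then obtain x where x: "x \<in> Q" "\<And>x'. x' \<in> Q \<Longrightarrow> infdist x' P \<le> infdist x P"
    using continuous_attains_sup[OF assms(3,4)] by blast
  have "(SUP x\<in>Q. infdist x P) = infdist x P"
    using x by (intro cSup_eq_maximum) auto
  then have d: "poly_dist P Q = infdist x P"
    by (simp add: poly_dist_def inf)
  have att: "\<exists>y\<in>P. infdist z P = norm (z - y)" for z
    using infdist_attains_inf[of P z] assms(1,2) by (auto simp: dist_norm compact_imp_closed)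
  have le: "infdist z P \<le> norm (z - y)" if "y \<in> P" for z y
    using infdist_le[OF that, of z] by (simp add: dist_norm)
  show ?thesis
  proof -
    obtain y where y: "y \<in> P" "infdist x P = norm (x - y)"
      using att by blast
    have "\<forall>y'\<in>P. norm (x - y) \<le> norm (x - y')"
      using le[of _ x] y(2) by simp
    moreover have "\<exists>y'\<in>P. norm (x' - y') \<le> norm (x - y)" if "x' \<in> Q" for x'
    proof -
      obtain y' where "y' \<in> P" "infdist x' P = norm (x' - y')"
        using att by blast
      then show ?thesis
        using x(2)[OF that] y(2) by auto
    qed
    ultimately show ?thesis
      using x(1) y d by (intro bexI[of _ x] bexI[of _ y]) auto
  qed
qed

lemma compact_symmetrized_budget_polytope:
  "compact (symmetrized (budget_polytope t :: (real ^ 'n) set))"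
proof -
  have "(budget_polytope t :: (real ^ 'n) set) =
      cbox (\<chi> i. 0) (\<chi> i. 1) \<inter> {x. (\<Sum>i\<in>UNIV. x $ i) \<le> t}"
    by (auto simp: budget_polytope_def mem_box_cart)
  moreover have "closed {x :: real ^ 'n. (\<Sum>i\<in>UNIV. x $ i) \<le> t}"
    by (intro closed_Collect_le continuous_intros)
  ultimately have c: "compact (budget_polytope t :: (real ^ 'n) set)"
    by (simp add: compact_Int_closed compact_cbox)
  have "continuous_on S (flip I)" for S :: "(real ^ 'n) set" and I
  proof -
    have "continuous_on S (\<lambda>x. if i \<in> I then x $ i else - x $ i)" for i
      by (cases "i \<in> I") (auto intro!: continuous_intros)
    then show ?thesis
      unfolding flip_def by (rule continuous_on_vec_lambda)
  qed
  then show ?thesis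
    unfolding symmetrized_def
    by (intro compact_convex_hull compact_UN compact_continuous_image c) auto
qed

lemma symmetrized_budget_polytope_nonempty:
  assumes "t \<ge> 0"
  shows "symmetrized (budget_polytope t) \<noteq> {}"
proof -
  have "0 \<in> budget_polytope t"
    using assms by (simp add: budget_polytope_def)
  then show ?thesis
    unfolding symmetrized_def by auto
qed

lemma subset_sparse_closure_with:
  assumes "\<forall>c\<in>D. valid_ineq P c"
  shows "P \<subseteq> sparse_closure_with k D P"
  using assms by (auto simp: sparse_closure_with_def sparse_closure_def valid_ineq_def)

lemma compact_sparse_closure_with:
  fixes P :: "(real ^ 'n) set"
  assumes "bounded P" "k > 0"
  shows "compact (sparse_closure_with k D P)"
proof -
  have "closed (\<Inter>(a, b)\<in>D. {x. a \<bullet> x \<le> b})"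
    by (auto intro!: closed_INT closed_halfspace_le)
  moreover have "sparse_closure k P =
      (\<Inter>(a, b)\<in>{(a, b). sparse k a \<and> valid_ineq P (a, b)}. {x. a \<bullet> x \<le> b})"
    by (auto simp: sparse_closure_def)
  then have "closed (sparse_closure k P)"
    by (auto intro!: closed_INT closed_halfspace_le)
  ultimately have cl: "closed (sparse_closure_with k D P)"
    unfolding sparse_closure_with_def by (rule closed_Int[rotated])
  obtain B where B: "\<And>x. x \<in> P \<Longrightarrow> norm x \<le> B"
    using assms(1) by (auto simp: bounded_iff)
  have le: "(s *\<^sub>R axis i 1) \<bullet> x \<le> B"
    if "x \<in> sparse_closure k P" "\<bar>s\<bar> = 1" for x i and s :: real
  proof -
    have "{j. (s *\<^sub>R axis i 1 :: real ^ 'n) $ j \<noteq> 0} \<subseteq> {i}"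
      by (auto simp: axis_def)
    then have "sparse k (s *\<^sub>R axis i 1 :: real ^ 'n)"
      using card_mono[of "{i}" "{j. (s *\<^sub>R axis i 1 :: real ^ 'n) $ j \<noteq> 0}"] assms(2)
      unfolding sparse_def by simp
    moreover have "valid_ineq P (s *\<^sub>R axis i 1, B)"
      unfolding valid_ineq_def
    proof
      fix y assume "y \<in> P"
      have "(s *\<^sub>R axis i 1) \<bullet> y \<le> norm (s *\<^sub>R axis i 1 :: real ^ 'n) * norm y"
        by (rule norm_cauchy_schwarz)
      then show "fst (s *\<^sub>R axis i 1, B) \<bullet> y \<le> snd (s *\<^sub>R axis i 1, B)"
        using B[OF \<open>y \<in> P\<close>] that(2) by (simp add: norm_axis_1)
    qed
    ultimately show ?thesis
      using that(1) by (auto simp: sparse_closure_def)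
  qed
  have "x \<in> cbox (\<chi> i. - B) (\<chi> i. B)" if "x \<in> sparse_closure k P" for x
  proof -
    have "x $ i \<le> B" "- B \<le> x $ i" for i
      using le[OF that, of 1 i] le[OF that, of "-1" i] by (auto simp: inner_axis')
    then show ?thesis
      by (simp add: mem_box_cart)
  qed
  then have "bounded (sparse_closure_with k D P)"
    unfolding sparse_closure_with_def by (intro bounded_subset[OF bounded_cbox]) blast
  with cl show ?thesis
    by (simp add: compact_eq_bounded_closed)
qed

end

theory Submission
  imports Defs
begin

text \<open>Coordinate projections of \<open>P\<close> onto at most \<open>n / 2\<close> coordinates are full cubes, so
  \<open>P\<^sup>k\<close> contains \<open>[-1,1]\<^sup>n\<close>. Every point \<open>2/3 \<cdot> \<sigma>\<close> with \<open>\<sigma>\<close> a sign vector has distance at least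
  \<open>\<surd>n / 6\<close> from \<open>P\<close>, because \<open>\<sigma> \<bullet> z \<le> n / 2\<close> on \<open>P\<close>. It remains to find \<open>\<sigma>\<close> such that this point
  satisfies all inequalities of \<open>D\<close>. Given \<open>\<alpha> x \<le> \<beta>\<close> valid for \<open>P\<close>, let \<open>H\<close> consist of the
  \<open>n / 2\<close> coordinates where \<open>\<bar>\<alpha>\<^sub>i\<bar>\<close> is largest; validity gives \<open>\<beta> \<ge> S = (\<Sum>i\<in>H. \<bar>\<alpha>\<^sub>i\<bar>)\<close>. The
  inequality can fail at \<open>2/3 \<cdot> \<sigma>\<close> only if the coordinates outside \<open>H\<close> contribute more than
  \<open>S / 2\<close> to \<open>\<alpha> \<sigma>\<close>, and since each of them is at most the average of \<open>\<bar>\<alpha>\<^sub>i\<bar>\<close> over \<open>H\<close>, a Chernoff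
  bound shows that this happens for a fraction of at most \<open>exp (- n / 32)\<close> of the sign vectors. A
  union bound over \<open>D\<close> concludes.\<close>

section \<open>Sign vectors, the symmetrized polytope and its sparse closure\<close>

lemma flip_nth [simp]: "flip A x $ i = (if i \<in> A then x $ i else - x $ i)"
  by (simp add: flip_def)

lemma mem_symmetrized_budget_polytope:
  fixes y :: "real ^ 'n"
  assumes "\<And>i. \<bar>y $ i\<bar> \<le> 1" "(\<Sum>i\<in>UNIV. \<bar>y $ i\<bar>) \<le> t"
  shows "y \<in> symmetrized (budget_polytope t)"
proof -
  have "(\<chi> i. \<bar>y $ i\<bar>) \<in> budget_polytope t"
    using assms by (simp add: budget_polytope_def)
  moreover have "y = flip {i. 0 \<le> y $ i} (\<chi> i. \<bar>y $ i\<bar>)"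
    by (simp add: vec_eq_iff)
  ultimately show ?thesis
    unfolding symmetrized_def by (intro hull_inc) blast
qed

text \<open>\<open>flip A 1\<close> is the sign vector that is +1 exactly on \<open>A\<close>.
  Against a reflection of a nonnegative \<open>x\<close> it gives a signed sum of the
  \<open>x $ i\<close>, hence at most their sum; the half-space is convex, so the bound passes to
  the hull.\<close>

lemma inner_sign_le_symmetrized_budget_polytope:
  fixes z :: "real ^ 'n"
  assumes "z \<in> symmetrized (budget_polytope t)"
  shows "flip A 1 \<bullet> z \<le> t"
proof -
  have "symmetrized (budget_polytope t) \<subseteq> {z :: real ^ 'n. flip A 1 \<bullet> z \<le> t}"
    unfolding symmetrized_def
  proof (rule hull_minimal)
    show "(\<Union>I. flip I ` budget_polytope t) \<subseteq> {z :: real ^ 'n. flip A 1 \<bullet> z \<le> t}"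
    proof clarsimp
      fix I and x :: "real ^ 'n" assume x: "x \<in> budget_polytope t"
      then have "flip A 1 \<bullet> flip I x \<le> (\<Sum>i\<in>UNIV. x $ i)"
        unfolding inner_vec_def by (intro sum_mono) (auto simp: budget_polytope_def)
      with x show "flip A 1 \<bullet> flip I x \<le> t"
        by (simp add: budget_polytope_def)
    qed
  qed (rule convex_halfspace_le)
  with assms show ?thesis by blast
qed

lemma norm_sign: "norm (flip A 1 :: real ^ 'n) = sqrt (real CARD('n))"
proof -
  have "(flip A 1 :: real ^ 'n) \<bullet> flip A 1 = (\<Sum>i\<in>(UNIV :: 'n set). 1)"
    unfolding inner_vec_def by (intro sum.cong) auto
  then show ?thesis
    by (simp add: norm_eq_sqrt_inner)
qed

lemma scaled_sign_far:
  fixes z :: "real ^ 'n"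
  assumes "z \<in> symmetrized (budget_polytope (real CARD('n) / 2))"
  shows "1 / 6 * sqrt (real CARD('n)) \<le> norm ((2/3) *\<^sub>R flip A 1 - z)"
proof -
  let ?\<sigma> = "flip A 1 :: real ^ 'n" and ?s = "sqrt (real CARD('n))"
  have "?\<sigma> \<bullet> ?\<sigma> = real CARD('n)"
    by (simp add: dot_square_norm norm_sign)
  \<comment> \<open>The gap is 2n/3 - n/2 = n/6; Cauchy-Schwarz then divides it by the norm of the
    sign vector, the square root of n.\<close>
  then have "real CARD('n) / 6 \<le> ?\<sigma> \<bullet> ((2/3) *\<^sub>R ?\<sigma> - z)"
    using inner_sign_le_symmetrized_budget_polytope[OF assms, of A]
    by (simp add: inner_diff_right)
  also have "\<dots> \<le> ?s * norm ((2/3) *\<^sub>R ?\<sigma> - z)"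
    using norm_cauchy_schwarz[of ?\<sigma>] by (simp add: norm_sign)
  finally have "?s * (1 / 6 * ?s) \<le> ?s * norm ((2/3) *\<^sub>R ?\<sigma> - z)"
    by simp
  then show ?thesis
    by (subst (asm) mult_le_cancel_left_pos) simp_all
qed

text \<open>A sparse \<open>a\<close> sees at most \<open>k\<close> coordinates of \<open>x\<close>.
  Setting the others to 0 leaves \<open>a \<bullet> x\<close> unchanged and lands in the polytope,
  as the absolute values then sum to at most \<open>k\<close>.\<close>

lemma cube_subset_sparse_closure:
  fixes x :: "real ^ 'n"
  assumes "real k \<le> t" "\<And>i. \<bar>x $ i\<bar> \<le> 1"
  shows "x \<in> sparse_closure k (symmetrized (budget_polytope t))"
  unfolding sparse_closure_def
proof (intro CollectI allI impI)
  fix a :: "real ^ 'n" and b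
  assume sp: "sparse k a" and val: "valid_ineq (symmetrized (budget_polytope t)) (a, b)"
  let ?K = "{i. a $ i \<noteq> 0}"
  define y where "y = (\<chi> i. if i \<in> ?K then x $ i else 0)"
  have "(\<Sum>i\<in>UNIV. \<bar>y $ i\<bar>) = (\<Sum>i\<in>?K. \<bar>x $ i\<bar>)"
    by (rule sum.mono_neutral_cong_right) (auto simp: y_def)
  also have "\<dots> \<le> real (card ?K) * 1"
    using assms(2) by (intro sum_bounded_above) auto
  also have "\<dots> \<le> t"
    using sp assms(1) unfolding sparse_def by linarith
  finally have "y \<in> symmetrized (budget_polytope t)"
    using assms(2) by (intro mem_symmetrized_budget_polytope) (auto simp: y_def)
  moreover have "a \<bullet> y = a \<bullet> x"
    unfolding inner_vec_def y_def by (intro sum.cong) auto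
  ultimately show "a \<bullet> x \<le> b"
    using val by (auto simp: valid_ineq_def)
qed

section \<open>Largest coordinates and exponential moments of sign vectors\<close>

lemma ex_largest_subset:
  fixes f :: "'a \<Rightarrow> 'b::linorder"
  assumes "finite U" "m \<le> card U"
  shows "\<exists>H\<subseteq>U. card H = m \<and> (\<forall>i\<in>H. \<forall>j\<in>U - H. f j \<le> f i)"
  using assms(2)
proof (induction m)
  case 0
  show ?case by (intro exI[of _ "{}"]) auto
next
  case (Suc m)
  then obtain H where H: "H \<subseteq> U" "card H = m" "\<forall>i\<in>H. \<forall>j\<in>U - H. f j \<le> f i"
    by auto
  have fin: "finite (U - H)" "finite H"
    using assms(1) H(1) finite_subset by auto
  have "U - H \<noteq> {}"
    using H Suc.prems by auto
  then obtain p where p: "p \<in> U - H" "\<forall>j\<in>U - H. f j \<le> f p"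
    using Max_in[of "f ` (U - H)"] Max_ge[of "f ` (U - H)"] fin(1)
    by (smt (verit, best) finite_imageI image_iff image_is_empty)
  show ?case
    using H p fin(2) by (intro exI[of _ "insert p H"]) auto
qed

text \<open>By symmetry take x nonnegative; then adding exp(x) <= 1 + x + x^2 and exp(-x) <= 1 - x +
  x^2 gives 2(1 + x^2) <= 2 exp(x^2).\<close>

lemma exp_add_exp_minus_le:
  fixes x :: real
  assumes "\<bar>x\<bar> \<le> 1"
  shows "exp x + exp (- x) \<le> 2 * exp (x\<^sup>2)"
proof -
  have *: "exp x + exp (- x) \<le> 2 * exp (x\<^sup>2)" if "0 \<le> x" "x \<le> 1" for x :: real
  proof -
    have "exp (- x) \<le> inverse (1 + x)"
      using that exp_ge_add_one_self[of x] by (simp add: exp_minus le_imp_inverse_le)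
    also have "\<dots> \<le> 1 - x + x\<^sup>2"
    proof -
      \<comment> \<open>The product equals 1 + x^3.\<close>
      have "1 \<le> (1 - x + x\<^sup>2) * (1 + x)"
        using that by (simp add: power2_eq_square algebra_simps)
      then show ?thesis
        using that by (simp add: inverse_eq_divide pos_divide_le_eq)
    qed
    finally show ?thesis
      using exp_bound[OF that] exp_ge_add_one_self[of "x\<^sup>2"] by linarith
  qed
  show ?thesis
    using *[of x] *[of "- x"] assms by (cases "0 \<le> x") auto
qed

text \<open>This is the moment bound for uniform random signs. Independence takes the form of
  expanding a product of two-term sums over all subsets \<open>A\<close>.\<close>

lemma sum_exp_sign_le:
  fixes d :: "real ^ 'n"
  assumes "\<And>i. \<bar>d $ i\<bar> \<le> 1"
  shows "(\<Sum>A\<in>UNIV. exp (d \<bullet> flip A 1)) \<le> 2 ^ CARD('n) * exp (d \<bullet> d)"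
proof -
  have "exp (d \<bullet> flip A 1) = (\<Prod>i\<in>A. exp (d $ i)) * (\<Prod>i\<in>UNIV - A. exp (- d $ i))" for A
  proof -
    have "d \<bullet> flip A 1 = (\<Sum>i\<in>A. d $ i) + (\<Sum>i\<in>UNIV - A. - d $ i)"
      unfolding inner_vec_def
      by (subst sum.subset_diff[of A]) (auto intro!: arg_cong2[where f = "(+)"] sum.cong)
    then show ?thesis
      by (simp add: exp_add exp_sum)
  qed
  then have "(\<Sum>A\<in>UNIV. exp (d \<bullet> flip A 1)) = (\<Prod>i\<in>UNIV. exp (d $ i) + exp (- d $ i))"
    by (subst prod_add) (auto simp: Pow_UNIV)
  also have "\<dots> \<le> (\<Prod>i\<in>UNIV. 2 * exp ((d $ i)\<^sup>2))"
    using exp_add_exp_minus_le[OF assms] by (intro prod_mono) (auto simp: add_nonneg_nonneg)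
  also have "\<dots> = 2 ^ CARD('n) * exp (d \<bullet> d)"
    by (simp add: prod.distrib exp_sum inner_vec_def power2_eq_square)
  finally show ?thesis .
qed

section \<open>Chernoff bound for one valid inequality\<close>

lemma card_violating_signs_le:
  fixes a :: "real ^ 'n"
  assumes ev: "even CARD('n)"
    and val: "valid_ineq (symmetrized (budget_polytope (real CARD('n) / 2))) (a, b)"
  shows "real (card {A. \<not> a \<bullet> ((2/3) *\<^sub>R flip A 1) \<le> b}) \<le>
      2 ^ CARD('n) * exp (- real CARD('n) / 32)"
proof -
  define n where "n = CARD('n)"
  let ?bad = "{A. \<not> a \<bullet> ((2/3) *\<^sub>R flip A 1) \<le> b}"
  obtain H where H: "card H = n div 2" "\<forall>i\<in>H. \<forall>j\<in>UNIV - H. \<bar>a $ j\<bar> \<le> \<bar>a $ i\<bar>"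
    using ex_largest_subset[of UNIV "n div 2" "\<lambda>i. \<bar>a $ i\<bar>"] by (auto simp: n_def)
  have n2: "real (card H) = real n / 2" and npos: "n > 0"
    using ev H(1) by (auto simp: n_def real_of_nat_div)
  then have Hne: "H \<noteq> {}" by auto
  \<comment> \<open>The minimum over \<open>H\<close> serves as the threshold: it bounds every
    coefficient outside \<open>H\<close> and is at most the average over \<open>H\<close>.\<close>
  define m where "m = Min ((\<lambda>i. \<bar>a $ i\<bar>) ` H)"
  define S where "S = (\<Sum>i\<in>H. \<bar>a $ i\<bar>)"
  define u :: "real ^ 'n" where "u = (\<chi> i. if i \<in> H then 0 else a $ i)"
  have mH: "m \<le> \<bar>a $ i\<bar>" if "i \<in> H" for i
    using that by (auto simp: m_def)
  have "m \<in> (\<lambda>i. \<bar>a $ i\<bar>) ` H"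
    unfolding m_def using Hne by (intro Min_in) auto
  then have m0: "0 \<le> m" and mT: "\<bar>u $ i\<bar> \<le> m" for i
    using H(2) by (auto simp: u_def)
  have Sm: "real n / 2 * m \<le> S"
    unfolding S_def n2[symmetric] using mH by (intro sum_bounded_below) auto
  have Sb: "S \<le> b"
  proof -
    \<comment> \<open>A point of the polytope with at most n/2 nonzero entries, all of them signs,
      at which \<open>a\<close> attains \<open>S\<close>.\<close>
    define p :: "real ^ 'n" where "p = (\<chi> i. if i \<in> H then sgn (a $ i) else 0)"
    have "(\<Sum>i\<in>UNIV. \<bar>p $ i\<bar>) \<le> (\<Sum>i\<in>UNIV. if i \<in> H then 1 else 0)"
      by (intro sum_mono) (auto simp: p_def abs_sgn_eq)
    also have "\<dots> = real n / 2"
      by (simp add: n2 sum.If_cases)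
    finally have "p \<in> symmetrized (budget_polytope (real n / 2))"
      by (intro mem_symmetrized_budget_polytope) (auto simp: p_def abs_sgn_eq)
    moreover have "a \<bullet> p = S"
      unfolding inner_vec_def S_def
      by (rule sum.mono_neutral_cong_right) (auto simp: p_def abs_sgn mult.commute)
    ultimately show ?thesis
      using val by (auto simp: valid_ineq_def n_def)
  qed
  have tail: "real n / 4 * m < u \<bullet> flip A 1" if "A \<in> ?bad" for A
  proof -
    have "a \<bullet> flip A 1 = (\<Sum>i\<in>H. a $ i * flip A 1 $ i) + (\<Sum>i\<in>UNIV - H. a $ i * flip A 1 $ i)"
      unfolding inner_vec_def by (subst sum.subset_diff[of H]) auto
    also have "(\<Sum>i\<in>H. a $ i * flip A 1 $ i) \<le> S"
      unfolding S_def by (intro sum_mono) auto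
    also have "(\<Sum>i\<in>UNIV - H. a $ i * flip A 1 $ i) = u \<bullet> flip A 1"
      unfolding inner_vec_def by (rule sum.mono_neutral_cong_left) (auto simp: u_def)
    finally have "a \<bullet> flip A 1 \<le> S + u \<bullet> flip A 1" by simp
    \<comment> \<open>Violation means a \<bullet> \<sigma> > 3b/2 >= 3S/2, so \<open>u\<close>
      contributes more than S/2 >= nm/4.\<close>
    with that Sb Sm show ?thesis by simp
  qed
  have "real (card ?bad) \<le> 2 ^ n * exp (- real n / 32)"
  proof (cases "m = 0")
    \<comment> \<open>Here no sign vector violates the inequality, since \<open>tail\<close> would
      read 0 < 0; this case is split off because the scaling below divides by
      \<open>m\<close>.\<close>
    case True
    then have "u = 0"
      using mT by (simp add: vec_eq_iff)
    with True tail have "?bad = {}"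
      by (metis (no_types, lifting) equals0I inner_zero_left less_irrefl mult_zero_right)
    then show ?thesis by (simp only: card.empty) simp
  next
    case False
    with m0 have mpos: "m > 0" by simp
    \<comment> \<open>The factor t = 1/(4m) minimizes the Chernoff exponent t^2 m^2 n/2 - t n m/4,
      with value n/32 - n/16 = -n/32.\<close>
    define d where "d = (1 / (4 * m)) *\<^sub>R u"
    have d4: "\<bar>d $ i\<bar> \<le> 1 / 4" for i
      using mT[of i] mpos by (simp add: d_def abs_mult field_simps)
    have "d \<bullet> d = (\<Sum>i\<in>UNIV - H. (d $ i)\<^sup>2)"
      unfolding inner_vec_def
      by (rule sum.mono_neutral_cong_right) (auto simp: d_def u_def power2_eq_square)
    also have "\<dots> \<le> real (card (UNIV - H)) * (1 / 16)"
    proof (rule sum_bounded_above)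
      fix i
      have "(d $ i)\<^sup>2 \<le> (1 / 4)\<^sup>2"
        using d4[of i] by (intro power2_le_iff_abs_le[THEN iffD2]) auto
      then show "(d $ i)\<^sup>2 \<le> 1 / 16" by (simp add: power2_eq_square)
    qed
    also have "card (UNIV - H) = n - card H"
      by (simp add: card_Diff_subset n_def)
    then have "real (card (UNIV - H)) = real n / 2"
      using n2 by linarith
    finally have dd: "d \<bullet> d \<le> real n / 32" by simp
    have "real n / 16 \<le> d \<bullet> flip A 1" if "A \<in> ?bad" for A
      using tail[OF that] mpos by (simp add: d_def field_simps)
    then have "real (card ?bad) * exp (real n / 16) \<le> (\<Sum>A\<in>?bad. exp (d \<bullet> flip A 1))"
      by (intro sum_bounded_below) auto
    also have "\<dots> \<le> (\<Sum>A\<in>UNIV. exp (d \<bullet> flip A 1))"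
      by (intro sum_mono2) auto
    also have "\<dots> \<le> 2 ^ n * exp (d \<bullet> d)"
      unfolding n_def
    proof (rule sum_exp_sign_le)
      show "\<bar>d $ i\<bar> \<le> 1" for i
        using d4[of i] by linarith
    qed
    also have "\<dots> \<le> 2 ^ n * exp (real n / 32)"
      using dd by simp
    also have "\<dots> = 2 ^ n * exp (- real n / 32) * exp (real n / 16)"
      by (simp add: mult.assoc exp_add[symmetric])
    finally show ?thesis by simp
  qed
  then show ?thesis by (simp add: n_def)
qed

section \<open>Union bound over the dense inequalities\<close>

theorem theorem6:
  fixes n k :: nat and P :: "(real ^ 'n) set" and D :: "((real ^ 'n) \<times> real) set"
  assumes "n = CARD('n)" and "even n"
    and "P = symmetrized (budget_polytope (real n / 2))"
    and "k > 0" and "real k \<le> real n / 100"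
    and "finite D" and "\<forall>c\<in>D. valid_ineq P c"
    and "real (card D) \<le> exp (real n / 600\<^sup>2)"
  shows "poly_dist P (sparse_closure_with k D P) \<ge> 1 / 6 * sqrt (real n)"
proof -
  define bad where "bad = (\<lambda>(a, b). {A. \<not> a \<bullet> ((2/3) *\<^sub>R flip A (1 :: real ^ 'n)) \<le> (b :: real)})"
  have npos: "real n > 0"
    using assms(4,5) by linarith
  have badc: "real (card (bad c)) \<le> 2 ^ n * exp (- real n / 32)" if "c \<in> D" for c
    using card_violating_signs_le[of "fst c" "snd c"] assms(1,2,3,7) that
    by (auto simp: bad_def split: prod.split)
  have "real (card (\<Union>c\<in>D. bad c)) \<le> (\<Sum>c\<in>D. real (card (bad c)))"
    using card_UN_le[OF assms(6), of bad] by (metis of_nat_le_iff of_nat_sum)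
  also have "\<dots> \<le> real (card D) * (2 ^ n * exp (- real n / 32))"
    using badc by (intro sum_bounded_above) auto
  also have "\<dots> \<le> exp (real n / 600\<^sup>2) * (2 ^ n * exp (- real n / 32))"
    using assms(8) by (intro mult_right_mono) auto
  also have "\<dots> = 2 ^ n * exp (real n / 600\<^sup>2 - real n / 32)"
    by (simp add: mult.left_commute flip: exp_add)
  \<comment> \<open>The exponent is negative because 1/600^2 < 1/32 and n > 0, so some sign vector
    is bad for no inequality in \<open>D\<close>.\<close>
  also have "\<dots> < 2 ^ n"
    using npos by simp
  also have "\<dots> = real (card (UNIV :: 'n set set))"
    by (simp add: assms(1) card_UNIV_set)
  finally have "(\<Union>c\<in>D. bad c) \<noteq> UNIV"
    by auto
  then obtain A where A: "\<And>c. c \<in> D \<Longrightarrow> A \<notin> bad c"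
    by blast
  let ?x = "(2/3) *\<^sub>R flip A (1 :: real ^ 'n)"
  have "?x \<in> sparse_closure k P"
    unfolding assms(3) using assms(5) npos by (intro cube_subset_sparse_closure) auto
  then have x: "?x \<in> sparse_closure_with k D P"
    using A by (fastforce simp: sparse_closure_with_def bad_def)
  have cP: "compact P" "P \<noteq> {}"
    unfolding assms(3)
    by (rule compact_symmetrized_budget_polytope, rule symmetrized_budget_polytope_nonempty) simp
  then have "compact (sparse_closure_with k D P)"
    using compact_sparse_closure_with compact_imp_bounded assms(4) by blast
  with poly_dist_max_min[OF cP this] x obtain y where "y \<in> P"
    "norm (?x - y) \<le> poly_dist P (sparse_closure_with k D P)"
    by (metis empty_iff)
  then show ?thesis
    using scaled_sign_far[of y A] assms(1,3) by simp
qed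

end
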